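(* Let $X$ be an infinite dimensional separable Banach space and $T:X\to X$ a continuous linear operator. Then $(X,T)$ is weakly mixing if and only if it is weakly transitive compact.
   Context: "Opene" means open and nonempty. $N_T(U,V)=\{n\in\mathbb{Z}_+:U\cap T^{-n}V\neq\varnothing\}$, $n_T(x,G)=\{n\in\mathbb{Z}_+:T^nx\in G\}$. $(X,T)$ is weakly mixing if $T\times T$ is topologically transitive on $X\times X$, i.e. $N_{T\times T}(A,B)\neq\varnothing$ for all opene $A,B\subset X\times X$. $(X,T)$ is weakly transitive compact if there is a dense subset $X_0\subset X$ such that for every $x\in X_0$ there exists $z\in X$ with $n_T(x,G)\cap N_T(U,V)\neq\varnothing$ for every neighbourhood $G$ of $z$ and all opene $U,V\subset X$. *)

theory Defs
  imports "HOL-Analysis.Analysis"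
begin

definition opene :: "'a::topological_space set \<Rightarrow> bool" where
  "opene U \<longleftrightarrow> open U \<and> U \<noteq> {}"

text \<open>Z_+ is read as the nonnegative integers, rendered as nat.\<close>
definition return_times :: "('a \<Rightarrow> 'a) \<Rightarrow> 'a set \<Rightarrow> 'a set \<Rightarrow> nat set" where
  "return_times T U V = {n. U \<inter> (T ^^ n) -` V \<noteq> {}}"

definition visit_times :: "('a \<Rightarrow> 'a) \<Rightarrow> 'a \<Rightarrow> 'a set \<Rightarrow> nat set" where
  "visit_times T x G = {n. (T ^^ n) x \<in> G}"

definition prod_map :: "('a \<Rightarrow> 'a) \<Rightarrow> ('a \<times> 'a \<Rightarrow> 'a \<times> 'a)" where
  "prod_map T = (\<lambda>(x, y). (T x, T y))"

definition weakly_mixing :: "('a::topological_space \<Rightarrow> 'a) \<Rightarrow> bool" where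
  "weakly_mixing T \<longleftrightarrow>
     (\<forall>A B :: ('a \<times> 'a) set. opene A \<and> opene B \<longrightarrow> return_times (prod_map T) A B \<noteq> {})"

definition weakly_transitive_compact :: "('a::topological_space \<Rightarrow> 'a) \<Rightarrow> bool" where
  "weakly_transitive_compact T \<longleftrightarrow>
     (\<exists>X0. closure X0 = UNIV \<and>
        (\<forall>x\<in>X0. \<exists>z. \<forall>G U V. (\<exists>W. open W \<and> z \<in> W \<and> W \<subseteq> G) \<and> opene U \<and> opene V
            \<longrightarrow> visit_times T x G \<inter> return_times T U V \<noteq> {}))"

definition separable_type :: "'a::topological_space itself \<Rightarrow> bool" where
  "separable_type _ \<longleftrightarrow> (\<exists>D :: 'a set. countable D \<and> closure D = UNIV)"

definition infinite_dimensional :: "'a::real_vector itself \<Rightarrow> bool" where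
  "infinite_dimensional _ \<longleftrightarrow> \<not> (\<exists>B :: 'a set. finite B \<and> span B = UNIV)"

end

theory Submission
  imports Defs
begin

text \<open>
  Call \<open>z\<close> a transitive limit point of \<open>x\<close> if the visits of \<open>x\<close> to each neighbourhood of \<open>z\<close> meet
  every return time set; weak transitive compactness says that the points having one are dense.
  If \<open>T\<close> is weakly mixing, then every \<open>z\<close> is a transitive limit point of all points of a dense
  \<open>G\<^sub>\<delta>\<close> set, by Baire's theorem.

  The converse goes through the three open sets condition: for opene \<open>U\<close>, \<open>V\<close> and a neighbourhood
  \<open>W\<close> of \<open>0\<close>, some iterate of \<open>T\<close> takes a point of \<open>U\<close> into \<open>W\<close> and a point of \<open>W\<close> into \<open>V\<close>.
  Adding the two points shows that the condition implies transitivity. It passes from \<open>T\<close> to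
  \<open>T \<times> T\<close>, since transitivity supplies points of the form \<open>(a, (T ^^ m) a)\<close> in every opene subset
  of the product; hence it implies weak mixing.

  To verify it, let \<open>z\<close> be a transitive limit point of \<open>x \<in> U\<close> and pick \<open>m\<close> such that \<open>T ^^ m\<close> takes
  some point near \<open>z\<close> into \<open>V\<close>. There are \<open>n\<close> and a small \<open>u\<close> such that \<open>(T ^^ n) x\<close> and
  \<open>(T ^^ n) u\<close> are both near \<open>z\<close> and \<open>(T ^^ (n + m)) u \<in> V\<close>. Then \<open>T ^^ n\<close> takes \<open>x - u \<in> U\<close>
  into \<open>W\<close> and \<open>(T ^^ m) u \<in> W\<close> into \<open>V\<close>.
\<close>

subsection \<open>Topological preliminaries\<close>

lemma closure_eq_UNIV_iff: "closure S = UNIV \<longleftrightarrow> (\<forall>U. opene U \<longrightarrow> U \<inter> S \<noteq> {})"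
proof
  assume "closure S = UNIV"
  then show "\<forall>U. opene U \<longrightarrow> U \<inter> S \<noteq> {}"
    by (metis Int_UNIV_right open_Int_closure_eq_empty opene_def)
next
  assume meets: "\<forall>U. opene U \<longrightarrow> U \<inter> S \<noteq> {}"
  have "open (- closure S)" "- closure S \<inter> S = {}"
    using closure_subset by auto
  with meets show "closure S = UNIV"
    by (auto simp: opene_def)
qed

lemma opene_Times: "opene A \<Longrightarrow> opene B \<Longrightarrow> opene (A \<times> B)"
  by (auto simp: opene_def open_Times)

lemma opene_contains_Times:
  assumes "opene C"
  obtains A B where "opene A" "opene B" "A \<times> B \<subseteq> C"
proof -
  obtain c where "c \<in> C" "open C"
    using assms by (auto simp: opene_def)
  then obtain A B where "open A" "open B" "c \<in> A \<times> B" "A \<times> B \<subseteq> C"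
    by (metis open_prod_elim)
  then show thesis
    using that by (auto simp: opene_def)
qed

lemma open_contains_diagonal_square:
  assumes "open C" "(x, x) \<in> C"
  obtains A where "open A" "x \<in> A" "A \<times> A \<subseteq> C"
proof -
  obtain A B where "open A" "open B" "x \<in> A" "x \<in> B" "A \<times> B \<subseteq> C"
    using open_prod_elim[OF assms] by (metis mem_Sigma_iff)
  then show thesis
    using that[of "A \<inter> B"] by blast
qed

lemma separable_type_countable_basis:
  assumes "separable_type TYPE('a::metric_space)"
  obtains \<B> :: "'a::metric_space set set" where "countable \<B>" "topological_basis \<B>"
proof -
  obtain D :: "'a set" where D: "countable D" "closure D = UNIV"
    using assms by (auto simp: separable_type_def)
  define \<B> where "\<B> = (\<lambda>(d, r). ball d r) ` (D \<times> \<rat>)"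
  have "topological_basis \<B>"
  proof (rule topological_basisI)
    show "open B" if "B \<in> \<B>" for B
      using that by (auto simp: \<B>_def)
  next
    fix U and x :: 'a assume "open U" "x \<in> U"
    then obtain e where e: "0 < e" "ball x e \<subseteq> U"
      by (meson openE)
    obtain r where r: "r \<in> \<rat>" "0 < r" "r < e / 2"
      using Rats_dense_in_real[of 0 "e / 2"] e by auto
    obtain d where d: "d \<in> D" "dist d x < r"
      using closure_approachable[of x D] D(2) r(2) by auto
    have "ball d r \<subseteq> ball x e"
    proof
      fix y assume "y \<in> ball d r"
      then show "y \<in> ball x e"
        using d(2) r(3) dist_triangle[of x y d] by (simp add: dist_commute)
    qed
    then have "ball d r \<in> \<B>" "x \<in> ball d r" "ball d r \<subseteq> U"
      using d r e by (auto simp: \<B>_def)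
    then show "\<exists>B\<in>\<B>. x \<in> B \<and> B \<subseteq> U" by blast
  qed
  moreover have "countable \<B>"
    using D by (simp add: \<B>_def countable_rat)
  ultimately show thesis
    using that by blast
qed

lemma dense_Inter_open_dense:
  fixes \<G> :: "'a::complete_space set set"
  assumes "countable \<G>" "\<And>G. G \<in> \<G> \<Longrightarrow> open G \<and> closure G = UNIV"
  shows "closure (\<Inter>\<G>) = UNIV"
  using Met_TC.metric_Baire_category[of \<G>] assms complete_UNIV by simp

lemma continuous_on_funpow:
  assumes "continuous_on S f" "f ` S \<subseteq> S"
  shows "continuous_on S (f ^^ n)"
proof (induction n)
  case 0
  show ?case by (simp add: id_def)
next
  case (Suc n)
  then have "continuous_on S (f ^^ n \<circ> f)"
    using assms by (intro continuous_on_compose continuous_on_subset[OF Suc])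
  then show ?case
    by (simp only: funpow_Suc_right)
qed

lemma open_vimage_funpow:
  fixes T :: "'a::topological_space \<Rightarrow> 'a"
  assumes "continuous_on UNIV T" "open V"
  shows "open ((T ^^ n) -` V)"
  using assms by (intro open_vimage continuous_on_funpow) auto

instance prod :: (topological_monoid_add, topological_monoid_add) topological_monoid_add
proof
  fix a b :: "'a \<times> 'b"
  have "(fst \<longlongrightarrow> a) (nhds (a, b))" "(snd \<longlongrightarrow> b) (nhds (a, b))"
    using tendsto_fst[OF filterlim_ident] tendsto_snd[OF filterlim_ident] by force+
  then show "LIM x nhds a \<times>\<^sub>F nhds b. fst x + snd x :> nhds (a + b)"
    unfolding plus_prod_def nhds_prod[symmetric]
    by (intro tendsto_Pair tendsto_add tendsto_fst tendsto_snd)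
qed

instance prod :: (topological_group_add, topological_group_add) topological_group_add
proof
  fix a :: "'a \<times> 'b"
  show "(uminus \<longlongrightarrow> - a) (nhds a)"
    unfolding uminus_prod_def
    by (intro tendsto_Pair tendsto_minus tendsto_fst tendsto_snd filterlim_ident)
qed

instance prod :: (topological_ab_group_add, topological_ab_group_add) topological_ab_group_add ..

subsection \<open>Return times, transitivity and weak mixing\<close>

lemma funpow_commute: "(f ^^ m) ((f ^^ n) x) = (f ^^ n) ((f ^^ m) x)"
  by (metis add.commute comp_apply funpow_add)

lemma funpow_prod_map: "(prod_map T ^^ n) (x, y) = ((T ^^ n) x, (T ^^ n) y)"
  by (induction n) (auto simp: prod_map_def)

lemma in_return_times_iff: "n \<in> return_times T U V \<longleftrightarrow> (\<exists>u\<in>U. (T ^^ n) u \<in> V)"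
  by (auto simp: return_times_def)

lemma return_timesI: "u \<in> U \<Longrightarrow> (T ^^ n) u \<in> V \<Longrightarrow> n \<in> return_times T U V"
  by (auto simp: in_return_times_iff)

lemma return_times_mono: "U \<subseteq> U' \<Longrightarrow> V \<subseteq> V' \<Longrightarrow> return_times T U V \<subseteq> return_times T U' V'"
  by (auto simp: return_times_def)

lemma return_times_prod_map:
  "return_times (prod_map T) (U1 \<times> U2) (V1 \<times> V2) = return_times T U1 V1 \<inter> return_times T U2 V2"
  by (auto simp: in_return_times_iff funpow_prod_map)

definition topologically_transitive :: "('a::topological_space \<Rightarrow> 'a) \<Rightarrow> bool" where
  "topologically_transitive T \<longleftrightarrow> (\<forall>U V. opene U \<longrightarrow> opene V \<longrightarrow> return_times T U V \<noteq> {})"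

lemma topologically_transitiveE:
  assumes "topologically_transitive T" "opene U" "opene V"
  obtains n u where "u \<in> U" "(T ^^ n) u \<in> V"
  using assms in_return_times_iff by (metis equals0I topologically_transitive_def)

lemma topologically_transitive_opene_Int_vimage:
  assumes "topologically_transitive T" "continuous_on UNIV T" "opene U" "opene V"
  obtains n where "opene (U \<inter> (T ^^ n) -` V)"
proof -
  obtain n u where "u \<in> U" "(T ^^ n) u \<in> V"
    using topologically_transitiveE assms by blast
  moreover have "open (U \<inter> (T ^^ n) -` V)"
    using assms by (auto simp: opene_def intro: open_vimage_funpow)
  ultimately show thesis
    using that[of n] by (auto simp: opene_def)
qed

lemma weakly_mixing_iff_transitive_prod_map:
  "weakly_mixing T \<longleftrightarrow> topologically_transitive (prod_map T)"
  by (auto simp: weakly_mixing_def topologically_transitive_def)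

lemma weakly_mixing_return_times_Int:
  assumes "weakly_mixing T" "opene U1" "opene V1" "opene U2" "opene V2"
  shows "return_times T U1 V1 \<inter> return_times T U2 V2 \<noteq> {}"
  using assms unfolding weakly_mixing_def return_times_prod_map[symmetric]
  by (simp add: opene_Times)

subsection \<open>Transitive limit points\<close>

definition transitive_limit_set :: "('a::topological_space \<Rightarrow> 'a) \<Rightarrow> 'a \<Rightarrow> 'a set" where
  "transitive_limit_set T x = {z. \<forall>G U V. open G \<longrightarrow> z \<in> G \<longrightarrow> opene U \<longrightarrow> opene V \<longrightarrow>
     visit_times T x G \<inter> return_times T U V \<noteq> {}}"

lemma transitive_limit_setE:
  assumes "z \<in> transitive_limit_set T x" "open G" "z \<in> G" "opene U" "opene V"
  obtains n u where "(T ^^ n) x \<in> G" "u \<in> U" "(T ^^ n) u \<in> V"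
proof -
  have "visit_times T x G \<inter> return_times T U V \<noteq> {}"
    using assms by (auto simp: transitive_limit_set_def)
  then show thesis
    using that by (auto simp: visit_times_def in_return_times_iff)
qed

lemma transitive_limit_set_eq_Inter_basis:
  fixes T :: "'a::topological_space \<Rightarrow> 'a"
  assumes "topological_basis \<B>"
  shows "{x. z \<in> transitive_limit_set T x} =
    (\<Inter>(G, U, V) \<in> {G \<in> \<B>. z \<in> G} \<times> (\<B> - {{}}) \<times> (\<B> - {{}}).
      {x. visit_times T x G \<inter> return_times T U V \<noteq> {}})" (is "_ = ?R")
proof (intro equalityI subsetI)
  fix x assume "x \<in> {x. z \<in> transitive_limit_set T x}"
  then show "x \<in> ?R"
    using topological_basis_open[OF assms]
    by (auto simp: transitive_limit_set_def opene_def)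
next
  fix x assume x: "x \<in> ?R"
  have "visit_times T x G \<inter> return_times T U V \<noteq> {}"
    if "open G" "z \<in> G" "opene U" "opene V" for G U V :: "'a set"
  proof -
    obtain G' where G': "G' \<in> \<B>" "z \<in> G'" "G' \<subseteq> G"
      using topological_basisE[OF assms \<open>open G\<close> \<open>z \<in> G\<close>] .
    have nonempty_basic_subset: "\<exists>B \<in> \<B> - {{}}. B \<subseteq> S" if "opene S" for S :: "'a set"
      using that assms by (metis DiffI all_not_in_conv opene_def singletonD topological_basisE)
    obtain U' V' where UV': "U' \<in> \<B> - {{}}" "U' \<subseteq> U" "V' \<in> \<B> - {{}}" "V' \<subseteq> V"
      using nonempty_basic_subset \<open>opene U\<close> \<open>opene V\<close> by meson
    have "visit_times T x G' \<inter> return_times T U' V' \<noteq> {}"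
      using x G' UV' by blast
    moreover have "visit_times T x G' \<subseteq> visit_times T x G"
      using G' by (auto simp: visit_times_def)
    ultimately show ?thesis
      using return_times_mono[OF UV'(2,4)] by blast
  qed
  then show "x \<in> {x. z \<in> transitive_limit_set T x}"
    by (simp add: transitive_limit_set_def)
qed

lemma weakly_transitive_compact_iff:
  fixes T :: "'a::topological_space \<Rightarrow> 'a"
  shows "weakly_transitive_compact T \<longleftrightarrow> closure {x. transitive_limit_set T x \<noteq> {}} = UNIV"
    (is "_ \<longleftrightarrow> closure ?L = UNIV")
proof -
  have limit_iff: "z \<in> transitive_limit_set T x \<longleftrightarrow>
      (\<forall>G U V. (\<exists>W. open W \<and> z \<in> W \<and> W \<subseteq> G) \<and> opene U \<and> opene V
        \<longrightarrow> visit_times T x G \<inter> return_times T U V \<noteq> {})" (is "_ \<longleftrightarrow> ?nbhd")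
    for x z :: 'a
  proof
    assume z: "z \<in> transitive_limit_set T x"
    show ?nbhd
    proof (intro allI impI, elim conjE exE)
      fix G U V W :: "'a set" assume W: "open W" "z \<in> W" "W \<subseteq> G" and UV: "opene U" "opene V"
      obtain n u where "(T ^^ n) x \<in> W" "u \<in> U" "(T ^^ n) u \<in> V"
        using transitive_limit_setE[OF z W(1,2) UV] .
      with W(3) show "visit_times T x G \<inter> return_times T U V \<noteq> {}"
        by (auto simp: visit_times_def intro: return_timesI)
    qed
  next
    assume ?nbhd
    then show "z \<in> transitive_limit_set T x"
      unfolding transitive_limit_set_def by blast
  qed
  have "weakly_transitive_compact T \<longleftrightarrow> (\<exists>X0. closure X0 = UNIV \<and> X0 \<subseteq> ?L)"
    unfolding weakly_transitive_compact_def limit_iff[symmetric] by blast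
  also have "\<dots> \<longleftrightarrow> closure ?L = UNIV"
    using closure_mono by (metis subset_refl top.extremum_uniqueI)
  finally show ?thesis .
qed

lemma weakly_transitive_compactE:
  assumes "weakly_transitive_compact T" "opene U"
  obtains x z where "x \<in> U" "z \<in> transitive_limit_set T x"
  using assms unfolding weakly_transitive_compact_iff closure_eq_UNIV_iff by blast

lemma weakly_transitive_compact_imp_transitive:
  fixes T :: "'a::topological_space \<Rightarrow> 'a"
  assumes "weakly_transitive_compact T"
  shows "topologically_transitive T"
  unfolding topologically_transitive_def
proof (intro allI impI)
  fix U V :: "'a set" assume UV: "opene U" "opene V"
  obtain x z where "z \<in> transitive_limit_set T x"
    using weakly_transitive_compactE[OF assms UV(1)] .
  then have "visit_times T x UNIV \<inter> return_times T U V \<noteq> {}"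
    using UV by (auto simp: transitive_limit_set_def)
  then show "return_times T U V \<noteq> {}"
    by blast
qed

subsection \<open>Weak mixing implies weak transitive compactness\<close>

lemma open_visit_times_Int:
  assumes "continuous_on UNIV T" "open G"
  shows "open {x. visit_times T x G \<inter> N \<noteq> {}}"
proof -
  have "{x. visit_times T x G \<inter> N \<noteq> {}} = (\<Union>n\<in>N. (T ^^ n) -` G)"
    by (auto simp: visit_times_def)
  then show ?thesis
    using assms by (auto intro: open_vimage_funpow)
qed

lemma weakly_mixing_dense_visit_times_Int:
  fixes T :: "'a::topological_space \<Rightarrow> 'a"
  assumes "weakly_mixing T" "opene G" "opene U" "opene V"
  shows "closure {x. visit_times T x G \<inter> return_times T U V \<noteq> {}} = UNIV"
  unfolding closure_eq_UNIV_iff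
proof (intro allI impI)
  fix W :: "'a set" assume "opene W"
  with assms have "return_times T W G \<inter> return_times T U V \<noteq> {}"
    by (intro weakly_mixing_return_times_Int)
  then show "W \<inter> {x. visit_times T x G \<inter> return_times T U V \<noteq> {}} \<noteq> {}"
    by (auto simp: visit_times_def return_times_def)
qed

lemma weakly_mixing_dense_transitive_limit:
  fixes T :: "'a::complete_space \<Rightarrow> 'a"
  assumes "separable_type TYPE('a)" "continuous_on UNIV T" "weakly_mixing T"
  shows "closure {x. z \<in> transitive_limit_set T x} = UNIV"
proof -
  obtain \<B> :: "'a set set" where \<B>: "countable \<B>" "topological_basis \<B>"
    using separable_type_countable_basis[OF assms(1)] .
  let ?visitors = "\<lambda>(G, U, V). {x. visit_times T x G \<inter> return_times T U V \<noteq> {}}"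
  let ?basic_triples = "{G \<in> \<B>. z \<in> G} \<times> (\<B> - {{}}) \<times> (\<B> - {{}})"
  have "closure (\<Inter>(?visitors ` ?basic_triples)) = UNIV"
  proof (rule dense_Inter_open_dense)
    have "countable {G \<in> \<B>. z \<in> G}"
      using \<B>(1) by (rule countable_subset[rotated]) auto
    then show "countable (?visitors ` ?basic_triples)"
      using \<B>(1) by (intro countable_image countable_SIGMA countable_Diff)
  next
    fix S assume "S \<in> ?visitors ` ?basic_triples"
    then obtain G U V where S: "S = {x. visit_times T x G \<inter> return_times T U V \<noteq> {}}"
      and opene: "opene G" "opene U" "opene V"
      using topological_basis_open[OF \<B>(2)] by (auto simp: opene_def)
    have "open S"
      using assms(2) opene(1) by (simp add: S opene_def open_visit_times_Int)
    moreover have "closure S = UNIV"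
      unfolding S using assms(3) opene by (rule weakly_mixing_dense_visit_times_Int)
    ultimately show "open S \<and> closure S = UNIV" ..
  qed
  then show ?thesis
    by (simp add: transitive_limit_set_eq_Inter_basis[OF \<B>(2)])
qed

lemma weakly_mixing_imp_weakly_transitive_compact:
  fixes T :: "'a::complete_space \<Rightarrow> 'a"
  assumes "separable_type TYPE('a)" "continuous_on UNIV T" "weakly_mixing T"
  shows "weakly_transitive_compact T"
proof -
  have "UNIV = closure {x. undefined \<in> transitive_limit_set T x}"
    using weakly_mixing_dense_transitive_limit[OF assms] by simp
  also have "\<dots> \<subseteq> closure {x. transitive_limit_set T x \<noteq> {}}"
    by (intro closure_mono) auto
  finally show ?thesis
    by (auto simp: weakly_transitive_compact_iff)
qed

subsection \<open>Three open sets condition\<close>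

definition three_open_sets_condition :: "('a::{topological_space, zero} \<Rightarrow> 'a) \<Rightarrow> bool" where
  "three_open_sets_condition T \<longleftrightarrow> (\<forall>U V W. opene U \<longrightarrow> opene V \<longrightarrow> open W \<longrightarrow> 0 \<in> W \<longrightarrow>
     return_times T U W \<inter> return_times T W V \<noteq> {})"

lemma three_open_sets_conditionE:
  assumes "three_open_sets_condition T" "opene U" "opene V" "open W" "0 \<in> W"
  obtains n u w where "u \<in> U" "(T ^^ n) u \<in> W" "w \<in> W" "(T ^^ n) w \<in> V"
proof -
  have "return_times T U W \<inter> return_times T W V \<noteq> {}"
    using assms by (auto simp: three_open_sets_condition_def)
  then show thesis
    using that by (auto simp: in_return_times_iff)
qed

lemma additive_funpow:
  fixes T :: "'a::ab_group_add \<Rightarrow> 'a"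
  assumes "Modules.additive T"
  shows "Modules.additive (T ^^ n)"
  using assms by (induction n) (simp_all add: Modules.additive_def)

lemma additive_prod_map: "Modules.additive T \<Longrightarrow> Modules.additive (prod_map T)"
  by (simp add: Modules.additive_def prod_map_def split_beta)

lemma opene_contains_perturbations:
  fixes S :: "'a::topological_monoid_add set"
  assumes "opene S"
  obtains P W where "opene P" "open W" "0 \<in> W" "\<And>p w. p \<in> P \<Longrightarrow> w \<in> W \<Longrightarrow> p + w \<in> S"
proof -
  obtain s where s: "s \<in> S" "open S"
    using assms by (auto simp: opene_def)
  have "open ((\<lambda>(p, w). p + w) -` S)"
    unfolding split_beta using s(2)
    by (intro open_vimage continuous_intros)
  then obtain P W where "open P" "open W" "(s, 0) \<in> P \<times> W" "P \<times> W \<subseteq> (\<lambda>(p, w). p + w) -` S"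
    using s(1) by (elim open_prod_elim[of _ "(s, 0)"]) auto
  then show thesis
    using that[of P W] by (fastforce simp: opene_def)
qed

lemma open_contains_differences:
  fixes W :: "'a::topological_group_add set"
  assumes "open W" "0 \<in> W"
  obtains G where "open G" "z \<in> G" "\<And>a b. a \<in> G \<Longrightarrow> b \<in> G \<Longrightarrow> a - b \<in> W"
proof -
  have "open ((\<lambda>(a, b). a - b) -` W)"
    unfolding split_beta using assms(1)
    by (intro open_vimage continuous_intros)
  then obtain G where "open G" "z \<in> G" "G \<times> G \<subseteq> (\<lambda>(a, b). a - b) -` W"
    using assms(2) by (elim open_contains_diagonal_square[of _ z]) auto
  then show thesis
    using that[of G] by fastforce
qed

lemma three_open_sets_imp_transitive:
  fixes T :: "'a::topological_ab_group_add \<Rightarrow> 'a"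
  assumes "Modules.additive T" "three_open_sets_condition T"
  shows "topologically_transitive T"
  unfolding topologically_transitive_def
proof (intro allI impI)
  fix U V :: "'a set" assume "opene U" "opene V"
  obtain U' W1 where U': "opene U'" "open W1" "0 \<in> W1"
      "\<And>u w. u \<in> U' \<Longrightarrow> w \<in> W1 \<Longrightarrow> u + w \<in> U"
    using opene_contains_perturbations[OF \<open>opene U\<close>] by blast
  obtain V' W2 where V': "opene V'" "open W2" "0 \<in> W2"
      "\<And>v w. v \<in> V' \<Longrightarrow> w \<in> W2 \<Longrightarrow> v + w \<in> V"
    using opene_contains_perturbations[OF \<open>opene V\<close>] by blast
  have W: "open (W1 \<inter> W2)" "0 \<in> W1 \<inter> W2"
    using U' V' by auto
  obtain n u w where u: "u \<in> U'" "(T ^^ n) u \<in> W1 \<inter> W2"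
    and w: "w \<in> W1 \<inter> W2" "(T ^^ n) w \<in> V'"
    using three_open_sets_conditionE[OF assms(2) U'(1) V'(1) W] .
  have "u + w \<in> U"
    using U'(4) u(1) w(1) by blast
  moreover have "(T ^^ n) (u + w) = (T ^^ n) w + (T ^^ n) u"
    using Modules.additive.add[OF additive_funpow[OF assms(1)]] by (simp add: add.commute)
  then have "(T ^^ n) (u + w) \<in> V"
    using V'(4) u(2) w(2) by simp
  ultimately show "return_times T U V \<noteq> {}"
    by (blast intro: return_timesI)
qed

lemma three_open_sets_prod_map:
  fixes T :: "'a::topological_ab_group_add \<Rightarrow> 'a"
  assumes "Modules.additive T" "continuous_on UNIV T" "three_open_sets_condition T"
  shows "three_open_sets_condition (prod_map T)"
  unfolding three_open_sets_condition_def
proof (intro allI impI)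
  fix U V W :: "('a \<times> 'a) set"
  assume opene: "opene U" "opene V" and W: "open W" "0 \<in> W"
  note transitive = three_open_sets_imp_transitive[OF assms(1,3)]
  obtain U1 U2 where U: "opene U1" "opene U2" "U1 \<times> U2 \<subseteq> U"
    using opene_contains_Times[OF opene(1)] .
  obtain V1 V2 where V: "opene V1" "opene V2" "V1 \<times> V2 \<subseteq> V"
    using opene_contains_Times[OF opene(2)] .
  obtain W1 where W1: "open W1" "0 \<in> W1" "W1 \<times> W1 \<subseteq> W"
    using open_contains_diagonal_square[of W 0] W unfolding zero_prod_def by blast
  obtain m where m: "opene (U1 \<inter> (T ^^ m) -` U2)"
    using topologically_transitive_opene_Int_vimage[OF transitive assms(2) U(1,2)] .
  obtain k where k: "opene (V1 \<inter> (T ^^ k) -` V2)"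
    using topologically_transitive_opene_Int_vimage[OF transitive assms(2) V(1,2)] .
  define W2 where "W2 = W1 \<inter> (T ^^ m) -` W1 \<inter> (T ^^ k) -` W1"
  have W2: "open W2" "0 \<in> W2"
    using W1 Modules.additive.zero[OF additive_funpow[OF assms(1)]]
    by (auto simp: W2_def intro!: open_vimage_funpow[OF assms(2)])
  obtain n u w where u: "u \<in> U1 \<inter> (T ^^ m) -` U2" "(T ^^ n) u \<in> W2"
    and w: "w \<in> W2" "(T ^^ n) w \<in> V1 \<inter> (T ^^ k) -` V2"
    using three_open_sets_conditionE[OF assms(3) m k W2] .
  have "(u, (T ^^ m) u) \<in> U" "(prod_map T ^^ n) (u, (T ^^ m) u) \<in> W"
    using u U(3) W1(3) by (auto simp: funpow_prod_map W2_def funpow_commute[of n])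
  moreover have "(w, (T ^^ k) w) \<in> W" "(prod_map T ^^ n) (w, (T ^^ k) w) \<in> V"
    using w V(3) W1(3) by (auto simp: funpow_prod_map W2_def funpow_commute[of n])
  ultimately show "return_times (prod_map T) U W \<inter> return_times (prod_map T) W V \<noteq> {}"
    by (blast intro: return_timesI)
qed

lemma three_open_sets_imp_weakly_mixing:
  fixes T :: "'a::topological_ab_group_add \<Rightarrow> 'a"
  assumes "Modules.additive T" "continuous_on UNIV T" "three_open_sets_condition T"
  shows "weakly_mixing T"
  unfolding weakly_mixing_iff_transitive_prod_map
  using assms
  by (intro three_open_sets_imp_transitive additive_prod_map three_open_sets_prod_map)

lemma weakly_transitive_compact_imp_three_open_sets:
  fixes T :: "'a::topological_ab_group_add \<Rightarrow> 'a"
  assumes "Modules.additive T" "continuous_on UNIV T" "weakly_transitive_compact T"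
  shows "three_open_sets_condition T"
  unfolding three_open_sets_condition_def
proof (intro allI impI)
  fix U V W :: "'a set" assume U: "opene U" and V: "opene V" and W: "open W" "0 \<in> W"
  obtain x z where x: "x \<in> U" and z: "z \<in> transitive_limit_set T x"
    using weakly_transitive_compactE[OF assms(3) U] .
  obtain G where G: "open G" "z \<in> G" and G_diff: "\<And>a b. a \<in> G \<Longrightarrow> b \<in> G \<Longrightarrow> a - b \<in> W"
    using open_contains_differences[OF W, of z] by blast
  have "opene G"
    using G by (auto simp: opene_def)
  then obtain m where m: "opene (G \<inter> (T ^^ m) -` V)"
    using topologically_transitive_opene_Int_vimage assms V
      weakly_transitive_compact_imp_transitive by blast
  define U' where "U' = (-) x -` U \<inter> (T ^^ m) -` W"
  have "open U'"
    unfolding U'_def using U W assms(2)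
    by (intro open_Int open_vimage open_vimage_funpow continuous_on_op_minus) (auto simp: opene_def)
  moreover have "0 \<in> U'"
    using x W Modules.additive.zero[OF additive_funpow[OF assms(1)]] by (simp add: U'_def)
  ultimately have "opene U'"
    by (auto simp: opene_def)
  with z G m obtain n u where n: "(T ^^ n) x \<in> G" and u: "u \<in> U'"
      "(T ^^ n) u \<in> G \<inter> (T ^^ m) -` V"
    by (elim transitive_limit_setE)
  have "(T ^^ n) (x - u) \<in> W"
    using G_diff n u(2) by (simp add: Modules.additive.diff[OF additive_funpow[OF assms(1)]])
  moreover have "(T ^^ n) ((T ^^ m) u) \<in> V"
    using u(2) by (simp add: funpow_commute[of n])
  moreover have "x - u \<in> U" "(T ^^ m) u \<in> W"
    using u(1) by (simp_all add: U'_def)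
  ultimately show "return_times T U W \<inter> return_times T W V \<noteq> {}"
    by (blast intro: return_timesI)
qed

theorem theorem7p1:
  fixes T :: "'a::banach \<Rightarrow> 'a"
  assumes "infinite_dimensional TYPE('a)"
    and "separable_type TYPE('a)"
    and "bounded_linear T"
  shows "weakly_mixing T \<longleftrightarrow> weakly_transitive_compact T"
proof
  have continuous: "continuous_on UNIV T"
    using assms(3) by (rule linear_continuous_on)
  show "weakly_transitive_compact T" if "weakly_mixing T"
    using assms(2) continuous that by (rule weakly_mixing_imp_weakly_transitive_compact)
  have additive: "Modules.additive T"
    using assms(3) by (simp add: Modules.additive_def linear_simps)
  show "weakly_mixing T" if "weakly_transitive_compact T"
  proof -
    have "three_open_sets_condition T"
      using additive continuous that by (rule weakly_transitive_compact_imp_three_open_sets)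
    with additive continuous show ?thesis
      by (rule three_open_sets_imp_weakly_mixing)
  qed
qed

end
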